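(* For every $n\in\mathbb{N}$, $$\sum_{k=0}^{2n}(-1)^kW_{-k}\star\tilde{G}_{2n-k}=(-1)^n[2]_q^{2n}(xxyy)^nx=\sum_{k=0}^{2n}(-1)^k\tilde{G}_{2n-k}\star W_{-k},$$ $$q^{-1}\sum_{k=0}^{2n+1}(-1)^kW_{-k}\star\tilde{G}_{2n+1-k}=(-1)^n[2]_q^{2n+1}(xxyy)^nxxy=q\sum_{k=0}^{2n+1}(-1)^k\tilde{G}_{2n+1-k}\star W_{-k}.$$
   Context: Let $\mathbb{F}$ be a field of characteristic zero and let $q\in\mathbb{F}$ be nonzero and not a root of unity; $\mathbb{N}=\{0,1,2,\ldots\}$; $[2]_q=q+q^{-1}$. Let $\mathbb{V}$ be the free associative unital $\mathbb{F}$-algebra on two noncommuting generators (letters) $x,y$; the words in $x,y$ (including the trivial word $\mathbf{1}$) form a basis of $\mathbb{V}$. Words such as $(xxyy)^nx$ are written with respect to the free (concatenation) product. The $q$-shuffle product $\star$ on the vector space $\mathbb{V}$ is the bilinear associative product with unit $\mathbf{1}$ determined as follows. Put $\langle x,x\rangle=\langle y,y\rangle=2$ and $\langle x,y\rangle=\langle y,x\rangle=-2$. For nontrivial words $u=u_1\cdots u_r$ and $v=v_1\cdots v_s$, $$u\star v=u_1\big((u_2\cdots u_r)\star v\big)+v_1\big(u\star(v_2\cdots v_s)\big)q^{\langle v_1,u_1\rangle+\cdots+\langle v_1,u_r\rangle}.$$ The alternating words are, for $n\in\mathbb{N}$ (powers in the free product): $\tilde{G}_{n+1}=(xy)^{n+1}$,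 $G_{n+1}=(yx)^{n+1}$, $W_{-n}=(xy)^nx$, $W_{n+1}=(yx)^ny$; also $G_0=\tilde{G}_0=\mathbf{1}$. *)

theory Defs
  imports Complex_Main "HOL-Library.Poly_Mapping"
begin

text \<open>Words under concatenation form a monoid, written additively because the convolution
  product of \<^theory>\<open>HOL-Library.Poly_Mapping\<close> expects its index monoid in this form.  The monoid
  algebra of finitely supported functions on words is then the free algebra: \<^term>\<open>(*)\<close> is the
  free product and \<^term>\<open>1\<close> the trivial word.\<close>

instantiation list :: (type) monoid_add
begin

definition zero_list :: "'a list" where "zero_list = []"
definition plus_list :: "'a list \<Rightarrow> 'a list \<Rightarrow> 'a list" where "plus_list = (@)"

instance by standard (simp_all add: zero_list_def plus_list_def)

end

datatype letter = X | Y

type_synonym 'k free_alg = "letter list \<Rightarrow>\<^sub>0 'k"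

definition word :: "letter list \<Rightarrow> 'k::field free_alg" where
  "word w = Poly_Mapping.single w 1"

definition xx :: "'k::field free_alg" where "xx = word [X]"
definition yy :: "'k::field free_alg" where "yy = word [Y]"

definition scale :: "'k::field \<Rightarrow> 'k free_alg \<Rightarrow> 'k free_alg" (infixr \<open>\<cdot>\<close> 75) where
  "c \<cdot> f = Poly_Mapping.map ((*) c) f"

definition pairing :: "letter \<Rightarrow> letter \<Rightarrow> int" where
  "pairing a b = (if a = b then 2 else -2)"

fun qshuffle_words :: "'k::field \<Rightarrow> letter list \<Rightarrow> letter list \<Rightarrow> 'k free_alg" where
  "qshuffle_words q [] v = word v"
| "qshuffle_words q u [] = word u"
| "qshuffle_words q (a # u) (b # v) =
     word [a] * qshuffle_words q u (b # v)
     + q powi (\<Sum>c\<leftarrow>a # u. pairing b c) \<cdot> (word [b] * qshuffle_words q (a # u) v)"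

definition qshuffle :: "'k::field \<Rightarrow> 'k free_alg \<Rightarrow> 'k free_alg \<Rightarrow> 'k free_alg" where
  "qshuffle q f g =
     (\<Sum>u\<in>Poly_Mapping.keys f. \<Sum>v\<in>Poly_Mapping.keys g.
        (Poly_Mapping.lookup f u * Poly_Mapping.lookup g v) \<cdot> qshuffle_words q u v)"

abbreviation qshuffle_syntax ::
  "'k::field free_alg \<Rightarrow> 'k \<Rightarrow> 'k free_alg \<Rightarrow> 'k free_alg" (\<open>(_ \<star>\<^bsub>_\<^esub> _)\<close> [71, 0, 71] 70) where
  "f \<star>\<^bsub>q\<^esub> g \<equiv> qshuffle q f g"

definition altG_tilde :: "nat \<Rightarrow> 'k::field free_alg" where
  "altG_tilde n = (xx * yy) ^ n"

text \<open>Both families of words \<open>W\<close> in one, indexed by the integers: nonpositive indices give the words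
  from \<open>x\<close> to \<open>x\<close>, positive ones those from \<open>y\<close> to \<open>y\<close>.\<close>

definition altW :: "int \<Rightarrow> 'k::field free_alg" where
  "altW k = (if k \<le> 0 then (xx * yy) ^ nat (- k) * xx else (yy * xx) ^ nat (k - 1) * yy)"

definition q2 :: "'k::field \<Rightarrow> 'k" where
  "q2 q = q + inverse q"

lemma lookup_scale [simp]: "Poly_Mapping.lookup (c \<cdot> f) w = c * Poly_Mapping.lookup f w"
  by (auto simp: scale_def Poly_Mapping.map.rep_eq when_def)

lemma word_mult: "word u * word v = word (u @ v)"
  by (simp add: word_def Poly_Mapping.mult_single plus_list_def)

lemma word_Nil: "word [] = 1"
  by (simp add: word_def zero_list_def flip: Poly_Mapping.single_one)

lemma qshuffle_word: "word u \<star>\<^bsub>q\<^esub> word v = qshuffle_words q u v"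
  by (rule poly_mapping_eqI) (simp add: qshuffle_def word_def)

lemma scale_add_left: "(a + b) \<cdot> f = a \<cdot> f + b \<cdot> f"
  by (rule poly_mapping_eqI) (simp add: lookup_add algebra_simps)

lemma scale_zero_left [simp]: "0 \<cdot> f = 0"
  by (rule poly_mapping_eqI) simp

lemma qshuffle_superset:
  assumes "finite A" "finite B" "Poly_Mapping.keys f \<subseteq> A" "Poly_Mapping.keys g \<subseteq> B"
  shows "f \<star>\<^bsub>q\<^esub> g = (\<Sum>u\<in>A. \<Sum>v\<in>B.
    (Poly_Mapping.lookup f u * Poly_Mapping.lookup g v) \<cdot> qshuffle_words q u v)"
proof -
  have "f \<star>\<^bsub>q\<^esub> g = (\<Sum>u\<in>Poly_Mapping.keys f. \<Sum>v\<in>B.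
    (Poly_Mapping.lookup f u * Poly_Mapping.lookup g v) \<cdot> qshuffle_words q u v)"
    unfolding qshuffle_def using assms
    by (intro sum.cong refl sum.mono_neutral_left) (auto simp: in_keys_iff)
  also have "\<dots> = (\<Sum>u\<in>A. \<Sum>v\<in>B.
    (Poly_Mapping.lookup f u * Poly_Mapping.lookup g v) \<cdot> qshuffle_words q u v)"
    using assms by (intro sum.mono_neutral_left) (auto simp: in_keys_iff)
  finally show ?thesis .
qed

lemma qshuffle_add_left: "(f + g) \<star>\<^bsub>q\<^esub> h = f \<star>\<^bsub>q\<^esub> h + g \<star>\<^bsub>q\<^esub> h"
proof -
  let ?A = "Poly_Mapping.keys f \<union> Poly_Mapping.keys g"
  have "Poly_Mapping.keys (f + g) \<subseteq> ?A" by (rule keys_add)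
  then show ?thesis
    by (simp add: qshuffle_superset[of ?A "Poly_Mapping.keys h"] lookup_add distrib_right
        scale_add_left sum.distrib)
qed

lemma qshuffle_add_right: "f \<star>\<^bsub>q\<^esub> (g + h) = f \<star>\<^bsub>q\<^esub> g + f \<star>\<^bsub>q\<^esub> h"
proof -
  let ?B = "Poly_Mapping.keys g \<union> Poly_Mapping.keys h"
  have "Poly_Mapping.keys (g + h) \<subseteq> ?B" by (rule keys_add)
  then show ?thesis
    by (simp add: qshuffle_superset[of "Poly_Mapping.keys f" ?B] lookup_add distrib_left
        scale_add_left sum.distrib)
qed

lemma scale_scale: "a \<cdot> b \<cdot> f = (a * b) \<cdot> f"
  by (rule poly_mapping_eqI) (simp add: mult.assoc)

lemma scale_sum_right: "a \<cdot> (\<Sum>i\<in>I. f i) = (\<Sum>i\<in>I. a \<cdot> f i)"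
  by (rule poly_mapping_eqI) (simp add: lookup_sum sum_distrib_left)

lemma keys_scale: "Poly_Mapping.keys (c \<cdot> f) \<subseteq> Poly_Mapping.keys f"
  by (auto simp: in_keys_iff)

lemma qshuffle_scale_left: "(c \<cdot> f) \<star>\<^bsub>q\<^esub> g = c \<cdot> (f \<star>\<^bsub>q\<^esub> g)"
  by (simp add: qshuffle_superset[of "Poly_Mapping.keys f" "Poly_Mapping.keys g"] keys_scale
      scale_sum_right scale_scale mult.assoc)

lemma qshuffle_scale_right: "f \<star>\<^bsub>q\<^esub> (c \<cdot> g) = c \<cdot> (f \<star>\<^bsub>q\<^esub> g)"
  by (simp add: qshuffle_superset[of "Poly_Mapping.keys f" "Poly_Mapping.keys g"] keys_scale
      scale_sum_right scale_scale mult_ac)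

end

theory Submission
  imports Defs
begin

text \<open>Expanding every product by its leftmost letters, the alternating sums of the products
  \<open>W\<^sub>-\<^sub>k \<star> G\<^sup>~\<^sub>m\<^sub>-\<^sub>k\<close>, \<open>G\<^sub>k \<star> G\<^sup>~\<^sub>m\<^sub>-\<^sub>k\<close>, \<open>W\<^sub>-\<^sub>k \<star> W\<^sub>m\<^sub>+\<^sub>1\<^sub>-\<^sub>k\<close>
  and \<open>G\<^sub>k \<star> W\<^sub>m\<^sub>+\<^sub>1\<^sub>-\<^sub>k\<close> form a closed system of recurrences: with \<open>P\<^sub>m\<close> the first and \<open>T\<^sub>m\<close>
  the last sum, cancellation leaves \<open>P\<^sub>m\<^sub>+\<^sub>1 = (1 + q\<^sup>2) xx T\<^sub>m\<close> and
  \<open>T\<^sub>m\<^sub>+\<^sub>1 = - (1 + q\<^sup>-\<^sup>2) yy P\<^sub>m\<close>, starting from \<open>P\<^sub>0 = x\<close> and \<open>T\<^sub>0 = y\<close>.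
  The products in the opposite order reduce to these, because exchanging the factors replaces
  \<open>q\<close> by its inverse, up to a power of \<open>q\<close> that is trivial for balanced words such as \<open>G\<^sup>~\<^sub>n\<close>.\<close>

section \<open>Scalars in the free algebra\<close>

lemma scale_add_right: "c \<cdot> (f + g) = c \<cdot> f + c \<cdot> g"
  by (rule poly_mapping_eqI) (simp add: lookup_add algebra_simps)

interpretation free_alg: module "scale :: 'k::field \<Rightarrow> 'k free_alg \<Rightarrow> 'k free_alg"
proof
  show "1 \<cdot> f = f" for f :: "'k free_alg"
    by (rule poly_mapping_eqI) simp
qed (simp_all add: scale_add_left scale_add_right scale_scale)

text \<open>Here \<open>0\<close> is the empty word, so these elements are the scalars. They are
  central because the empty word is neutral on both sides and coefficients commute; additivity
  extends this from monomials to all \<open>f\<close>.\<close>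

lemma single_zero_commute:
  fixes f :: "'k::field free_alg"
  shows "Poly_Mapping.single 0 c * f = f * Poly_Mapping.single 0 c"
proof (induction f rule: update_induct)
  case (update f w b)
  then have "Poly_Mapping.update w b f = Poly_Mapping.single w b + f"
    by (intro poly_mapping_eqI)
      (auto simp: lookup_update lookup_add lookup_single when_def in_keys_iff)
  with update show ?case
    by (simp add: mult_single distrib_left distrib_right mult.commute[of b])
qed simp

lemma scale_mult_right: "f * (c \<cdot> g) = c \<cdot> (f * g)"
proof -
  have "f * (Poly_Mapping.single 0 c * g) = Poly_Mapping.single 0 c * (f * g)"
    by (metis mult.assoc single_zero_commute)
  then show ?thesis
    by (simp add: scale_def mult_map_scale_conv_mult)
qed

lemma qshuffle_words_Nil_right [simp]: "qshuffle_words q u [] = word u"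
  by (cases u) simp_all

section \<open>Exchanging the factors of a q-shuffle product\<close>

definition word_pairing :: "letter list \<Rightarrow> letter list \<Rightarrow> int" where
  "word_pairing u v = (\<Sum>a\<leftarrow>u. \<Sum>b\<leftarrow>v. pairing a b)"

lemma word_pairing_Cons_left: "word_pairing (a # u) v = (\<Sum>b\<leftarrow>v. pairing a b) + word_pairing u v"
  by (simp add: word_pairing_def)

lemma word_pairing_Cons_right: "word_pairing u (b # v) = (\<Sum>a\<leftarrow>u. pairing b a) + word_pairing u v"
  by (simp add: word_pairing_def sum_list_addf pairing_def eq_commute)

text \<open>The two summands of the recursion trade places. The exponent attached to the first
  letter in either order is exactly what \<open>word_pairing\<close> loses when that letter is
  removed.\<close>

lemma qshuffle_words_commute:
  "q \<noteq> 0 \<Longrightarrow> qshuffle_words q u v = q powi word_pairing u v \<cdot> qshuffle_words (inverse q) v u"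
proof (induction q u v rule: qshuffle_words.induct)
  case (3 q a u b v)
  have 1: "q powi word_pairing u (b # v)
      = q powi word_pairing (a # u) (b # v) * inverse q powi (\<Sum>c\<leftarrow>b # v. pairing a c)"
    using 3(3) unfolding word_pairing_Cons_left[of a u "b # v"]
    by (simp add: power_int_add power_int_inverse field_simps)
  have 2: "q powi (\<Sum>c\<leftarrow>a # u. pairing b c) * q powi word_pairing (a # u) v
      = q powi word_pairing (a # u) (b # v)"
    using 3(3) unfolding word_pairing_Cons_right[of "a # u"]
    by (simp add: power_int_add)
  show ?case
    unfolding qshuffle_words.simps 3(1)[OF 3(3)] 3(2)[OF 3(3)] scale_mult_right scale_scale
      scale_add_right 1 2
    by (rule add.commute)
qed (simp_all add: word_pairing_def)

section \<open>Alternating words\<close>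

fun swap_letter :: "letter \<Rightarrow> letter" where
  "swap_letter X = Y"
| "swap_letter Y = X"

text \<open>A single family for all alternating words, closed under deleting the first letter: even
  lengths give the two kinds of G, odd lengths the two kinds of W.\<close>

fun alt :: "letter \<Rightarrow> nat \<Rightarrow> letter list" where
  "alt a 0 = []"
| "alt a (Suc n) = a # alt (swap_letter a) n"

lemma pairing_swap: "pairing b (swap_letter a) = - pairing b a"
  by (cases a; cases b) (simp_all add: pairing_def)

text \<open>Neighbouring letters cancel, so only the parity of the length and the first letter
  matter.\<close>

lemma sum_pairing_alt: "(\<Sum>c\<leftarrow>alt a n. pairing b c) = (if even n then 0 else pairing b a)"
  by (induction a n rule: alt.induct) (auto simp: pairing_swap)

lemma word_pairing_alt_even: "even n \<Longrightarrow> word_pairing u (alt a n) = 0"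
  by (simp add: word_pairing_def sum_pairing_alt)

text \<open>The conditionals absorb the cases with one empty factor, so that one rewrite rule serves
  every term of the sums below.\<close>

lemma qshuffle_words_alt:
  assumes "i + j > 0"
  shows "qshuffle_words q (alt a i) (alt b j) =
     (if i = 0 then 0 else word [a] * qshuffle_words q (alt (swap_letter a) (i - 1)) (alt b j))
   + (if j = 0 then 0 else (q powi (if even i then 0 else pairing b a)) \<cdot>
       (word [b] * qshuffle_words q (alt a i) (alt (swap_letter b) (j - 1))))"
proof (cases i; cases j)
  fix i' j' assume *: "i = Suc i'" "j = Suc j'"
  show ?thesis
    using sum_pairing_alt[of b a "Suc i'"] by (simp add: *)
qed (use assms in \<open>simp_all add: word_mult\<close>)

section \<open>Alternating sums and their recurrences\<close>

lemma sum_if_zero_shift: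
  "(\<Sum>k\<le>Suc m. if k = 0 then 0 else f (k - 1)) = (\<Sum>k\<le>m. f k :: 'a::comm_monoid_add)"
  by (simp add: sum.atMost_Suc_shift del: sum.atMost_Suc)

lemma sum_if_last:
  "(\<Sum>k\<le>Suc m. if k = Suc m then 0 else f k) = (\<Sum>k\<le>m. f k :: 'a::comm_monoid_add)"
  by simp

definition sum_WGt :: "'k::field \<Rightarrow> nat \<Rightarrow> 'k free_alg" where
  "sum_WGt q m = (\<Sum>k\<le>m. (-1) ^ k \<cdot> qshuffle_words q (alt X (2*k+1)) (alt X (2*(m-k))))"

definition sum_GGt :: "'k::field \<Rightarrow> nat \<Rightarrow> 'k free_alg" where
  "sum_GGt q m = (\<Sum>k\<le>m. (-1) ^ k \<cdot> qshuffle_words q (alt Y (2*k)) (alt X (2*(m-k))))"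

definition sum_WW :: "'k::field \<Rightarrow> nat \<Rightarrow> 'k free_alg" where
  "sum_WW q m = (\<Sum>k\<le>m. (-1) ^ k \<cdot> qshuffle_words q (alt X (2*k+1)) (alt Y (2*(m-k)+1)))"

definition sum_GW :: "'k::field \<Rightarrow> nat \<Rightarrow> 'k free_alg" where
  "sum_GW q m = (\<Sum>k\<le>m. (-1) ^ k \<cdot> qshuffle_words q (alt Y (2*k)) (alt Y (2*(m-k)+1)))"

lemma sum_split_shift:
  assumes "\<And>k. k \<le> Suc m \<Longrightarrow> t k = (if k = 0 then 0 else f (k - 1)) + (if k = Suc m then 0 else g k)"
  shows "(\<Sum>k\<le>Suc m. t k) = (\<Sum>k\<le>m. f k) + (\<Sum>k\<le>m. g k :: 'a::comm_monoid_add)"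
proof -
  have "(\<Sum>k\<le>Suc m. t k)
      = (\<Sum>k\<le>Suc m. (if k = 0 then 0 else f (k - 1)) + (if k = Suc m then 0 else g k))"
    using assms by (intro sum.cong) auto
  then show ?thesis
    by (simp only: sum.distrib sum_if_zero_shift sum_if_last)
qed

text \<open>Both words have odd length, hence no boundary terms; y passing an odd word that starts
  with x costs \<open>q powi -2\<close>.\<close>

lemma sum_WW_eq: "sum_WW q m = xx * sum_GW q m + q powi -2 \<cdot> (yy * sum_WGt q m)"
proof -
  have "sum_WW q m
      = (\<Sum>k\<le>m. (-1) ^ k \<cdot> (xx * qshuffle_words q (alt Y (2*k)) (alt Y (2*(m-k)+1)))
        + ((-1) ^ k * q powi -2) \<cdot> (yy * qshuffle_words q (alt X (2*k+1)) (alt X (2*(m-k)))))"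
    unfolding sum_WW_def
    by (intro sum.cong refl, subst qshuffle_words_alt)
      (auto simp: scale_add_right scale_scale xx_def yy_def pairing_def simp del: alt.simps)
  also have "\<dots> = xx * sum_GW q m + q powi -2 \<cdot> (yy * sum_WGt q m)"
    unfolding sum.distrib sum_GW_def sum_WGt_def sum_distrib_left
      scale_sum_right scale_mult_right scale_scale
    by (simp only: mult.commute)
  finally show ?thesis .
qed

text \<open>Even left factors contribute no power of q. The minus sign comes from shifting the index
  in the terms that start with y, which are absent at \<open>k = 0\<close>.\<close>

lemma sum_GGt_Suc:
  fixes q :: "'k::field"
  shows "sum_GGt q (Suc m) = xx * sum_GW q m - yy * sum_WGt q m"
proof -
  have "sum_GGt q (Suc m)
      = (\<Sum>k\<le>m. - ((-1) ^ k \<cdot> (yy * qshuffle_words q (alt X (2*k+1)) (alt X (2*(m-k))))))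
      + (\<Sum>k\<le>m. (-1) ^ k \<cdot> (xx * qshuffle_words q (alt Y (2*k)) (alt Y (2*(m-k)+1))))"
    unfolding sum_GGt_def
  proof (rule sum_split_shift)
    fix k assume k: "k \<le> Suc m"
    have j: "2 * (Suc m - k) - 1 = 2 * (m - k) + 1" if "k \<noteq> Suc m"
      using k that by simp
    have i: "2 * k - 1 = 2 * (k - 1) + 1" "2 * (Suc m - k) = 2 * (m - (k - 1))"
        "(- 1) ^ k = - ((- 1) ^ (k - 1) :: 'k)" if "k \<noteq> 0"
      using k that by (cases k; simp)+
    show "(-1) ^ k \<cdot> qshuffle_words q (alt Y (2*k)) (alt X (2*(Suc m-k)))
       = (if k = 0 then 0 else
          - ((-1) ^ (k-1) \<cdot> (yy * qshuffle_words q (alt X (2*(k-1)+1)) (alt X (2*(m-(k-1)))))))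
       + (if k = Suc m then 0 else
          (-1) ^ k \<cdot> (xx * qshuffle_words q (alt Y (2*k)) (alt Y (2*(m-k)+1))))"
      using i j k by (subst qshuffle_words_alt)
        (auto simp: scale_add_right xx_def yy_def simp del: alt.simps)
  qed
  then show ?thesis
    by (simp add: sum_GW_def sum_WGt_def sum_distrib_left scale_mult_right sum_negf)
qed

text \<open>Both words start with x, so x factors out; taking it from the right word means passing
  an odd word, at cost \<open>q powi 2\<close>.\<close>

lemma sum_WGt_Suc: "sum_WGt q (Suc m) = xx * (sum_GGt q (Suc m) + q powi 2 \<cdot> sum_WW q m)"
proof -
  have "sum_WGt q (Suc m)
      = (\<Sum>k\<le>Suc m. (-1) ^ k \<cdot> (xx * qshuffle_words q (alt Y (2*k)) (alt X (2*(Suc m-k))))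
        + (if k = Suc m then 0 else
          ((-1) ^ k * q powi 2) \<cdot> (xx * qshuffle_words q (alt X (2*k+1)) (alt Y (2*(m-k)+1)))))"
    unfolding sum_WGt_def
  proof (rule sum.cong[OF refl])
    fix k assume "k \<in> {..Suc m}"
    then have "2 * (Suc m - k) - 1 = 2 * (m - k) + 1" if "k \<noteq> Suc m"
      using that by simp
    with \<open>k \<in> {..Suc m}\<close>
    show "(-1) ^ k \<cdot> qshuffle_words q (alt X (2*k+1)) (alt X (2*(Suc m-k)))
      = (-1) ^ k \<cdot> (xx * qshuffle_words q (alt Y (2*k)) (alt X (2*(Suc m-k))))
        + (if k = Suc m then 0 else
          ((-1) ^ k * q powi 2) \<cdot> (xx * qshuffle_words q (alt X (2*k+1)) (alt Y (2*(m-k)+1))))"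
      by (subst qshuffle_words_alt)
        (auto simp: scale_add_right scale_scale xx_def pairing_def simp del: alt.simps)
  qed
  also have "\<dots> = xx * (sum_GGt q (Suc m) + q powi 2 \<cdot> sum_WW q m)"
    unfolding sum.distrib sum_if_last sum_GGt_def sum_WW_def distrib_left sum_distrib_left
      scale_sum_right scale_mult_right scale_scale
    by (simp only: mult.commute)
  finally show ?thesis .
qed

lemma sum_GW_Suc:
  fixes q :: "'k::field"
  shows "sum_GW q (Suc m) = yy * (sum_GGt q (Suc m) - sum_WW q m)"
proof -
  have "sum_GW q (Suc m)
      = (\<Sum>k\<le>Suc m. (if k = 0 then 0 else
          - ((-1) ^ (k-1) \<cdot> (yy * qshuffle_words q (alt X (2*(k-1)+1)) (alt Y (2*(m-(k-1))+1)))))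
        + (-1) ^ k \<cdot> (yy * qshuffle_words q (alt Y (2*k)) (alt X (2*(Suc m-k)))))"
    unfolding sum_GW_def
  proof (rule sum.cong[OF refl])
    fix k assume k: "k \<in> {..Suc m}"
    have "2 * k - 1 = 2 * (k - 1) + 1" "2 * (Suc m - k) = 2 * (m - (k - 1))"
        "(- 1) ^ k = - ((- 1) ^ (k - 1) :: 'k)" if "k \<noteq> 0"
      using k that by (cases k; simp)+
    then show "(-1) ^ k \<cdot> qshuffle_words q (alt Y (2*k)) (alt Y (2*(Suc m-k)+1))
      = (if k = 0 then 0 else
          - ((-1) ^ (k-1) \<cdot> (yy * qshuffle_words q (alt X (2*(k-1)+1)) (alt Y (2*(m-(k-1))+1)))))
        + (-1) ^ k \<cdot> (yy * qshuffle_words q (alt Y (2*k)) (alt X (2*(Suc m-k))))"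
      by (subst qshuffle_words_alt)
        (auto simp: scale_add_right yy_def simp del: alt.simps)
  qed
  also have "\<dots> = yy * (sum_GGt q (Suc m) - sum_WW q m)"
    unfolding sum.distrib
      sum_if_zero_shift[of "\<lambda>k. - ((-1) ^ k \<cdot> (yy * qshuffle_words q (alt X (2*k+1)) (alt Y (2*(m-k)+1))))"]
      sum_GGt_def sum_WW_def right_diff_distrib sum_distrib_left scale_mult_right sum_negf
    by simp
  finally show ?thesis .
qed

text \<open>The two contributions of \<open>yy * sum_WGt q m\<close> cancel, while those of
  \<open>xx * sum_GW q m\<close> add up.\<close>

lemma sum_WGt_Suc_sum_GW:
  assumes "q \<noteq> 0"
  shows "sum_WGt q (Suc m) = (1 + q\<^sup>2) \<cdot> (xx * xx * sum_GW q m)"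
proof -
  have "q\<^sup>2 * q powi -2 = 1"
    using assms by (simp add: power_int_minus)
  then show ?thesis
    by (simp add: sum_WGt_Suc sum_GGt_Suc sum_WW_eq scale_add_right scale_add_left scale_scale
        scale_mult_right distrib_left right_diff_distrib mult.assoc)
qed

text \<open>This time the contributions of \<open>xx * sum_GW q m\<close> cancel.\<close>

lemma sum_GW_Suc_sum_WGt: "sum_GW q (Suc m) = - ((1 + q powi -2) \<cdot> (yy * yy * sum_WGt q m))"
  by (simp add: sum_GW_Suc sum_GGt_Suc sum_WW_eq scale_add_right scale_add_left scale_scale
        scale_mult_right distrib_left right_diff_distrib mult.assoc)

section \<open>Closed forms\<close>

lemma sum_WGt_0: "sum_WGt q 0 = xx"
  by (simp add: sum_WGt_def xx_def)

lemma sum_WGt_1: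
  assumes "q \<noteq> 0"
  shows "sum_WGt q (Suc 0) = (q * q2 q) \<cdot> (xx * xx * yy)"
  using assms
  by (simp add: sum_WGt_Suc_sum_GW sum_GW_def yy_def q2_def distrib_left power2_eq_square add.commute)

lemma sum_WGt_add_2:
  assumes "q \<noteq> 0"
  shows "sum_WGt q (Suc (Suc m)) = (- (q2 q)\<^sup>2) \<cdot> (xx * xx * yy * yy * sum_WGt q m)"
proof -
  have "(1 + q\<^sup>2) * (1 + q powi -2) = (q2 q)\<^sup>2"
    using assms by (simp add: q2_def power_int_minus power2_eq_square field_simps)
  then show ?thesis
    using assms by (simp add: sum_WGt_Suc_sum_GW sum_GW_Suc_sum_WGt scale_mult_right scale_scale mult.assoc)
qed

lemma sum_WGt_even:
  assumes "q \<noteq> 0"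
  shows "sum_WGt q (2 * n) = ((-1) ^ n * q2 q ^ (2*n)) \<cdot> ((xx * xx * yy * yy) ^ n * xx)"
proof (induction n)
  case (Suc n)
  then show ?case
    using assms by (simp add: sum_WGt_add_2 scale_mult_right scale_scale mult.assoc
        power2_eq_square mult.left_commute)
qed (simp add: sum_WGt_0)

text \<open>The extra factor \<open>q\<close> enters at the base case, through
  \<open>1 + q^2 = q * q2 q\<close>.\<close>

lemma sum_WGt_odd:
  assumes "q \<noteq> 0"
  shows "sum_WGt q (2*n+1)
    = (q * ((-1) ^ n * q2 q ^ (2*n+1))) \<cdot> ((xx * xx * yy * yy) ^ n * xx * xx * yy)"
proof (induction n)
  case (Suc n)
  then show ?case
    using assms by (simp add: sum_WGt_add_2 scale_mult_right scale_scale mult.assoc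
        power2_eq_square mult.left_commute)
qed (use assms in \<open>simp add: sum_WGt_1\<close>)

section \<open>Back to the products in both orders\<close>

lemma altG_tilde_eq: "altG_tilde n = word (alt X (2 * n))"
proof (induction n)
  case (Suc n)
  then show ?case
    by (simp add: altG_tilde_def xx_def yy_def word_mult)
qed (simp add: altG_tilde_def word_Nil)

lemma altW_eq: "altW (- int n) = word (alt X (2 * n + 1))"
proof (induction n)
  case (Suc n)
  then show ?case
    by (simp add: altW_def xx_def yy_def word_mult mult.assoc nat_add_distrib)
qed (simp add: altW_def xx_def)

lemma sum_altW_altG_tilde:
  "(\<Sum>k=0..m. (-1) ^ k \<cdot> (altW (- int k) \<star>\<^bsub>q\<^esub> altG_tilde (m - k))) = sum_WGt q m"
  by (simp only: sum_WGt_def altW_eq altG_tilde_eq qshuffle_word atMost_atLeast0)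

lemma sum_altG_tilde_altW:
  assumes "q \<noteq> 0"
  shows "(\<Sum>k=0..m. (-1) ^ k \<cdot> (altG_tilde (m - k) \<star>\<^bsub>q\<^esub> altW (- int k))) = sum_WGt (inverse q) m"
proof -
  have "altG_tilde l \<star>\<^bsub>q\<^esub> altW (- int k) = altW (- int k) \<star>\<^bsub>inverse q\<^esub> altG_tilde l" for k l
    \<comment> \<open>Taken at \<open>inverse q\<close>, so that the exchanged product is the one at
      \<open>q\<close>; the right word is balanced, so the power of q is trivial.\<close>
    using qshuffle_words_commute[of "inverse q" "alt X (2*k+1)" "alt X (2*l)"] assms
    by (simp add: altW_eq altG_tilde_eq qshuffle_word word_pairing_alt_even del: alt.simps)
  then show ?thesis
    by (simp add: sum_altW_altG_tilde)
qed

theorem proposition5p5: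
  fixes q :: "'k::field_char_0" and n :: nat
  assumes q_nonzero: "q \<noteq> 0"
    and q_not_root_of_unity: "\<And>m::nat. m > 0 \<Longrightarrow> q ^ m \<noteq> 1"
  shows
    "(\<Sum>k=0..2*n. (-1) ^ k \<cdot> (altW (- int k) \<star>\<^bsub>q\<^esub> altG_tilde (2*n - k)))
       = ((-1) ^ n * q2 q ^ (2*n)) \<cdot> ((xx * xx * yy * yy) ^ n * xx)
     \<and> ((-1) ^ n * q2 q ^ (2*n)) \<cdot> ((xx * xx * yy * yy) ^ n * xx)
       = (\<Sum>k=0..2*n. (-1) ^ k \<cdot> (altG_tilde (2*n - k) \<star>\<^bsub>q\<^esub> altW (- int k)))
     \<and> inverse q \<cdot> (\<Sum>k=0..2*n+1. (-1) ^ k \<cdot> (altW (- int k) \<star>\<^bsub>q\<^esub> altG_tilde (2*n + 1 - k)))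
       = ((-1) ^ n * q2 q ^ (2*n + 1)) \<cdot> ((xx * xx * yy * yy) ^ n * xx * xx * yy)
     \<and> ((-1) ^ n * q2 q ^ (2*n + 1)) \<cdot> ((xx * xx * yy * yy) ^ n * xx * xx * yy)
       = q \<cdot> (\<Sum>k=0..2*n+1. (-1) ^ k \<cdot> (altG_tilde (2*n + 1 - k) \<star>\<^bsub>q\<^esub> altW (- int k)))"
proof -
  have q2: "q2 (inverse q) = q2 q" and inv: "inverse q \<noteq> 0"
    using q_nonzero by (simp_all add: q2_def add.commute)
  \<comment> \<open>In the odd case the closed form carries \<open>q\<close> in one order and
    \<open>inverse q\<close> in the other; the outer factors of the theorem remove them.\<close>
  have "inverse q * (q * c) = c" "q * (inverse q * c) = c" for c
    using q_nonzero by simp_all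
  then show ?thesis
    by (simp only: sum_altW_altG_tilde sum_altG_tilde_altW[OF q_nonzero] sum_WGt_even[OF q_nonzero]
        sum_WGt_odd[OF q_nonzero] sum_WGt_even[OF inv] sum_WGt_odd[OF inv] q2 scale_scale simp_thms)
qed

end
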